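(* Let $X$ be a real Hilbert space and let $C$ be a closed convex subset of $X$ with $0\in C$. Then, in $X\times\mathbb{R}$, $$\big(\overline{\operatorname{cone}}(C\times\{1\})\big)^\ominus = \operatorname{cone}\big(C^\odot\times\{-1\}\big)\uplus \big(C^\ominus \times\{0\}\big) = \operatorname{cone}\big(C^\odot\times\{-1\}\big)\uplus \big(\operatorname{rec}(C^\odot) \times\{0\}\big) = \overline{\operatorname{cone}}\big(C^\odot\times\{-1\}\big).$$
   Context: $X$ is a real Hilbert space with inner product $\langle\cdot,\cdot\rangle$; $X\times\mathbb{R}$ carries the inner product $\langle (x,r),(y,s)\rangle=\langle x,y\rangle+rs$. For a subset $S$ of a real Hilbert space, $\operatorname{cone}(S):=\bigcup_{\rho>0}\rho S$ (note $\rho>0$), and $\overline{\operatorname{cone}}(S)$ is the closure of $\operatorname{cone}(S)$. The polar cone of $S$ is $S^\ominus:=\{u : \langle s,u\rangle\le 0 \text{ for all } s\in S\}$ (taken in the Hilbert space containing $S$). The polar set of $C$ is $C^\odot:=\{x\in X : \langle c,x\rangle\le 1\text{ for all } c\in C\}$. The recession cone of a convex set $D\subseteq X$ is $\operatorname{rec}(D):=\{x\in X : x+D\subseteq D\}$. The symbol $\uplus$ denotes a union and includes the assertion that the two sets are disjoint. *)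

theory Defs
  imports "HOL-Analysis.Analysis"
begin

text \<open>
  A real Hilbert space is a type of sort \<open>{real_inner, complete_space}\<close>. The library's product
  instance gives \<open>X \<times> \<real>\<close> the inner product \<open>inner x y + r * s\<close>
  (see \<open>inner_prod_def\<close>) and the topology induced by it.
\<close>

text \<open>
  The scalars are strictly positive, so this differs from the library's \<open>cone hull S\<close>, which
  contains \<open>0\<close> whenever \<open>S\<close> is nonempty.
\<close>

definition pos_cone :: "'a::real_vector set \<Rightarrow> 'a set" where
  "pos_cone S = (\<Union>\<rho>\<in>{0<..}. (\<lambda>x. \<rho> *\<^sub>R x) ` S)"

definition closed_pos_cone :: "'a::real_normed_vector set \<Rightarrow> 'a set" where
  "closed_pos_cone S = closure (pos_cone S)"

definition polar_cone :: "'a::real_inner set \<Rightarrow> 'a set" where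
  "polar_cone S = {u. \<forall>s\<in>S. inner s u \<le> 0}"

definition polar_set :: "'a::real_inner set \<Rightarrow> 'a set" where
  "polar_set C = {x. \<forall>c\<in>C. inner c x \<le> 1}"

definition recession_cone :: "'a::real_vector set \<Rightarrow> 'a set" where
  "recession_cone D = {x. (\<lambda>d. x + d) ` D \<subseteq> D}"

end

theory Submission
  imports Defs
begin

text \<open>
  A pair \<open>(y, s)\<close> lies in the polar cone of \<open>C \<times> {1}\<close> iff \<open>\<langle>c, y\<rangle> + s \<le> 0\<close> for all \<open>c \<in> C\<close>, and passing
  to the closed cone does not change the polar cone. As \<open>0 \<in> C\<close>, this forces \<open>s \<le> 0\<close>. If \<open>s < 0\<close>,
  the condition says that \<open>y / (- s)\<close> lies in the polar set of \<open>C\<close>, so \<open>(y, s)\<close> belongs to the cone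
  over \<open>polar_set C \<times> {-1}\<close>; if \<open>s = 0\<close>, it says that \<open>y \<in> polar_cone C\<close>. The two parts are separated
  by the last coordinate.

  The polar cone of \<open>C\<close> is the recession cone of its polar set: if \<open>x\<close> is a recession direction, then
  every multiple \<open>n x\<close> lies in the polar set, so \<open>\<langle>c, x\<rangle> \<le> 1 / n\<close> for all \<open>n\<close>.

  Finally, the union is a polar cone, hence closed, so it contains the closed cone over
  \<open>polar_set C \<times> {-1}\<close>. Conversely, for \<open>y \<in> polar_cone C\<close> the point \<open>(y, 0)\<close> is the limit of
  \<open>(y, - 1 / n) = (1 / n) (n y, - 1)\<close>, where \<open>n y\<close> lies in the polar set.
\<close>

lemma mem_pos_cone_iff: "z \<in> pos_cone S \<longleftrightarrow> (\<exists>\<rho>>0. \<exists>s\<in>S. z = \<rho> *\<^sub>R s)"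
  by (auto simp: pos_cone_def)

lemma pos_coneI: "\<rho> > 0 \<Longrightarrow> s \<in> S \<Longrightarrow> \<rho> *\<^sub>R s \<in> pos_cone S"
  by (auto simp: mem_pos_cone_iff)

lemma closed_polar_cone: "closed (polar_cone S)"
proof -
  have "polar_cone S = (\<Inter>s\<in>S. {u. inner s u \<le> 0})"
    by (auto simp: polar_cone_def)
  moreover have "closed {u. inner s u \<le> 0}" for s :: 'a
    by (intro closed_Collect_le continuous_intros)
  ultimately show ?thesis
    by auto
qed

lemma polar_cone_pos_cone: "polar_cone (pos_cone S) = polar_cone S"
proof
  show "polar_cone (pos_cone S) \<subseteq> polar_cone S"
  proof
    fix u assume u: "u \<in> polar_cone (pos_cone S)"
    have "s \<in> pos_cone S" if "s \<in> S" for s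
      using that by (auto simp: mem_pos_cone_iff intro!: exI[of _ 1])
    then show "u \<in> polar_cone S"
      using u by (auto simp: polar_cone_def)
  qed
  show "polar_cone S \<subseteq> polar_cone (pos_cone S)"
    by (auto simp: polar_cone_def mem_pos_cone_iff mult_le_0_iff)
qed

lemma polar_cone_closure: "polar_cone (closure S) = polar_cone S"
proof
  show "polar_cone (closure S) \<subseteq> polar_cone S"
    using closure_subset by (auto simp: polar_cone_def)
  show "polar_cone S \<subseteq> polar_cone (closure S)"
  proof
    fix u assume u: "u \<in> polar_cone S"
    have "closed {s. inner s u \<le> 0}"
      by (intro closed_Collect_le continuous_intros)
    then have "closure S \<subseteq> {s. inner s u \<le> 0}"
      using u by (intro closure_minimal) (auto simp: polar_cone_def)
    then show "u \<in> polar_cone (closure S)"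
      by (auto simp: polar_cone_def)
  qed
qed

lemma polar_cone_closed_pos_cone: "polar_cone (closed_pos_cone S) = polar_cone S"
  by (simp add: closed_pos_cone_def polar_cone_closure polar_cone_pos_cone)

lemma mem_polar_cone_times_one_iff:
  "(y, s) \<in> polar_cone (C \<times> {1::real}) \<longleftrightarrow> (\<forall>c\<in>C. inner c y + s \<le> 0)"
  by (auto simp: polar_cone_def)

text \<open>
  Of the cone over \<open>polar_set C \<times> {-1}\<close>, the slice at height \<open>s < 0\<close> is \<open>- s\<close> times the polar set,
  described here without division.
\<close>

lemma mem_pos_cone_polar_set_iff:
  "(y, s) \<in> pos_cone (polar_set C \<times> {-1::real}) \<longleftrightarrow> s < 0 \<and> (\<forall>c\<in>C. inner c y + s \<le> 0)"
proof
  assume "(y, s) \<in> pos_cone (polar_set C \<times> {-1::real})"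
  then obtain \<rho> x where "\<rho> > 0" "x \<in> polar_set C" "y = \<rho> *\<^sub>R x" "s = - \<rho>"
    by (auto simp: mem_pos_cone_iff)
  then show "s < 0 \<and> (\<forall>c\<in>C. inner c y + s \<le> 0)"
    by (auto simp: polar_set_def)
next
  assume *: "s < 0 \<and> (\<forall>c\<in>C. inner c y + s \<le> 0)"
  then have x: "((1 / - s) *\<^sub>R y, - 1) \<in> polar_set C \<times> {-1::real}"
    by (auto simp: polar_set_def field_simps)
  have s: "- s > 0"
    using * by simp
  then show "(y, s) \<in> pos_cone (polar_set C \<times> {-1::real})"
    using pos_coneI[OF s x] by simp
qed

lemma polar_cone_times_one:
  assumes "0 \<in> C"
  shows "polar_cone (C \<times> {1::real}) = pos_cone (polar_set C \<times> {-1}) \<union> polar_cone C \<times> {0}"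
proof (rule set_eqI)
  fix z :: "'a \<times> real"
  obtain y s where z: "z = (y, s)"
    by (cases z)
  have "s \<le> 0" if "\<forall>c\<in>C. inner c y + s \<le> 0"
    using that assms by force
  moreover have "y \<in> polar_cone C \<longleftrightarrow> (\<forall>c\<in>C. inner c y \<le> 0)"
    by (simp add: polar_cone_def)
  ultimately show "z \<in> polar_cone (C \<times> {1}) \<longleftrightarrow>
      z \<in> pos_cone (polar_set C \<times> {-1}) \<union> polar_cone C \<times> {0}"
    unfolding z by (auto simp: mem_polar_cone_times_one_iff mem_pos_cone_polar_set_iff)
qed

lemma recession_cone_polar_set: "recession_cone (polar_set C) = polar_cone C"
proof
  show "polar_cone C \<subseteq> recession_cone (polar_set C)"
    by (fastforce simp: recession_cone_def polar_set_def polar_cone_def inner_add_right)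
  show "recession_cone (polar_set C) \<subseteq> polar_cone C"
  proof
    fix x assume "x \<in> recession_cone (polar_set C)"
    then have step: "x + d \<in> polar_set C" if "d \<in> polar_set C" for d
      using that by (auto simp: recession_cone_def)
    have multiple: "real n *\<^sub>R x \<in> polar_set C" for n
    proof (induction n)
      case 0
      show ?case by (simp add: polar_set_def)
    next
      case (Suc n)
      from step[OF this] show ?case by (simp add: algebra_simps)
    qed
    show "x \<in> polar_cone C"
      unfolding polar_cone_def
    proof safe
      fix c assume "c \<in> C"
      with multiple have bound: "real n * inner c x \<le> 1" for n
        by (auto simp: polar_set_def)
      show "inner c x \<le> 0"
      proof (rule ccontr)
        assume "\<not> inner c x \<le> 0"
        then obtain n where "1 < real n * inner c x"
          using reals_Archimedean3[of "inner c x"] by auto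
        with bound[of n] show False by simp
      qed
    qed
  qed
qed

text \<open>Horizontal directions from the polar cone of \<open>C\<close> are limits of points of slightly negative height.\<close>

lemma polar_cone_times_zero_subset:
  "polar_cone C \<times> {0} \<subseteq> closed_pos_cone (polar_set C \<times> {-1::real})"
proof safe
  fix y assume y: "y \<in> polar_cone C"
  have "(y, - inverse (real (Suc n))) \<in> pos_cone (polar_set C \<times> {-1})" for n
    unfolding mem_pos_cone_polar_set_iff
  proof (intro conjI ballI)
    have pos: "0 < inverse (real (Suc n))" by simp
    then show "- inverse (real (Suc n)) < 0" by linarith
    fix c assume "c \<in> C"
    with y have "inner c y \<le> 0" by (simp add: polar_cone_def)
    with pos show "inner c y + - inverse (real (Suc n)) \<le> 0" by linarith
  qed
  moreover have "(\<lambda>n. (y, - inverse (real (Suc n)))) \<longlonglongrightarrow> (y, - 0)"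
    by (intro tendsto_intros LIMSEQ_inverse_real_of_nat)
  ultimately have "(y, - 0::real) \<in> closed_pos_cone (polar_set C \<times> {-1})"
    unfolding closed_pos_cone_def closure_sequential
    by (intro exI[of _ "\<lambda>n. (y, - inverse (real (Suc n)))"]) simp
  then show "(y, 0) \<in> closed_pos_cone (polar_set C \<times> {-1::real})"
    by simp
qed

lemma closed_pos_cone_polar_set:
  assumes "0 \<in> C"
  shows "closed_pos_cone (polar_set C \<times> {-1::real})
    = pos_cone (polar_set C \<times> {-1}) \<union> polar_cone C \<times> {0}" (is "?K = ?U")
proof
  have "closed ?U"
    using closed_polar_cone polar_cone_times_one[OF assms] by metis
  then show "?K \<subseteq> ?U"
    unfolding closed_pos_cone_def by (intro closure_minimal) auto
  show "?U \<subseteq> ?K"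
    using polar_cone_times_zero_subset closure_subset by (auto simp: closed_pos_cone_def)
qed

theorem theorem3p1:
  fixes C :: "'a::{real_inner, complete_space} set"
  assumes "closed C" and "convex C" and "0 \<in> C"
  shows
    "polar_cone (closed_pos_cone (C \<times> {1::real}))
       = pos_cone (polar_set C \<times> {-1}) \<union> (polar_cone C \<times> {0})
     \<and> pos_cone (polar_set C \<times> {-1::real}) \<inter> (polar_cone C \<times> {0}) = {}
     \<and> pos_cone (polar_set C \<times> {-1::real}) \<union> (polar_cone C \<times> {0})
       = pos_cone (polar_set C \<times> {-1}) \<union> (recession_cone (polar_set C) \<times> {0})
     \<and> pos_cone (polar_set C \<times> {-1::real}) \<inter> (recession_cone (polar_set C) \<times> {0}) = {}
     \<and> pos_cone (polar_set C \<times> {-1::real}) \<union> (recession_cone (polar_set C) \<times> {0})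
       = closed_pos_cone (polar_set C \<times> {-1})"
proof -
  have "pos_cone (polar_set C \<times> {-1::real}) \<inter> (polar_cone C \<times> {0}) = {}"
    by (auto simp: mem_pos_cone_polar_set_iff)
  then show ?thesis
    using assms(3) by (simp add: polar_cone_closed_pos_cone polar_cone_times_one
        recession_cone_polar_set closed_pos_cone_polar_set)
qed

end
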